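(* Let $F=\sum_{I\in\mathcal I}t_I$ be a tropical polynomial of $n$ variables $t_1,\dots,t_n$, where $\mathcal I$ is a nonempty subset of the power set $2^{[n]}$. Then $F$ is realisable if and only if there exists a poset structure on the index set $[n]$ such that, for every $I\subset[n]$, $$I\ \text{is a maximal totally ordered subset}\iff t_I\ \text{is a term of}\ F .$$
   Context: $[n]=\{1,\dots,n\}$, $n\ge1$. Tropical (max-plus) arithmetic is used: tropical addition (written $\oplus$ or $\sum$) is $\max$, tropical multiplication is ordinary addition. For $I\subset[n]$, $t_I=\prod_{i\in I}t_i$ is the tropical monomial with value $\sum_{i\in I}t_i$ (ordinary sum). Tropical polynomials are regarded as formal expressions; the terms of $\sum_{I\in\mathcal I}t_I$ are exactly the $t_I$ with $I\in\mathcal I$. A PERT chart with activity set $[n]$ is a finite simple directed graph (no loops, no multiple arrows) with vertex set $[n]\cup\{u,y\}$ ($u$ the start, $y$ the end), without directed cycles, such that every vertex is reachable from $u$ and $y$ is reachable from every vertex, and without short-cuts: if there is a directed path $x_0\to x_1\to\cdots\to x_k$ with $k\ge2$, then there is no arrow $x_0\to x_k$. A path of the chart is the set $I\subset[n]$ of activities (omitting $u,y$) on a directed path from $u$ to $y$. With time cost $t_i\ge0$ for activity $i$, the earliest finishing time is the tropical polynomial $\sum t_I$, the tropical sum being over all paths $I$ (i.e. the maximum over all paths of the total time cost). $F$ is (PERT-)realisable if there exists a PERT chart with activity set $[n]$ whose earliest finishing time is $F$. *)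

theory Defs
  imports "HOL-Library.Extended_Real" "HOL-Library.Multiset"
begin

text \<open>
  A formal max-plus polynomial in variables indexed by \<open>nat\<close> is given by its coefficients: a
  multiset of variable indices encodes a monomial, and the coefficient \<open>-\<infinity>\<close> (the tropical zero)
  means that the monomial does not occur. Polynomials are added by taking the maximum of the
  coefficients. Two different polynomials may well define the same function of the \<open>t\<^sub>i\<close>.
\<close>

type_synonym trop_poly = "nat multiset \<Rightarrow> ereal"

text \<open>The formal monomial \<open>t\<^sub>I\<close>; its coefficient \<open>0\<close> is the tropical one.\<close>

definition trop_monom :: "nat set \<Rightarrow> trop_poly" where
  "trop_monom I = (\<lambda>m. if m = mset_set I then 0 else -\<infinity>)"

definition trop_sum :: "nat set set \<Rightarrow> trop_poly" where
  "trop_sum \<I> = (SUP I\<in>\<I>. trop_monom I)"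

definition is_term :: "nat set \<Rightarrow> trop_poly \<Rightarrow> bool" where
  "is_term I F \<longleftrightarrow> F (mset_set I) = 0"

lemma is_term_trop_sum:
  assumes "\<I> \<subseteq> Pow {1..n}" "I \<subseteq> {1..n}"
  shows "is_term I (trop_sum \<I>) \<longleftrightarrow> I \<in> \<I>"
proof
  assume I: "I \<in> \<I>"
  have "(SUP J\<in>\<I>. trop_monom J (mset_set I)) = 0"
    by (rule SUP_eqI) (use I in \<open>force simp: trop_monom_def\<close>)+
  then show "is_term I (trop_sum \<I>)"
    by (simp add: is_term_def trop_sum_def image_image)
next
  assume "is_term I (trop_sum \<I>)"
  then have eq: "(SUP J\<in>\<I>. trop_monom J (mset_set I)) = 0"
    by (simp add: is_term_def trop_sum_def image_image)
  show "I \<in> \<I>"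
  proof (rule ccontr)
    assume nI: "I \<notin> \<I>"
    have "trop_monom J (mset_set I) = -\<infinity>" if "J \<in> \<I>" for J
    proof -
      have "finite I" "finite J"
        using assms that by (auto intro: finite_subset)
      then have "mset_set I \<noteq> mset_set J"
        using that nI by (metis finite_set_mset_mset_set)
      then show ?thesis by (simp add: trop_monom_def)
    qed
    then have "(SUP J\<in>\<I>. trop_monom J (mset_set I)) \<le> -\<infinity>"
      by (intro SUP_least) simp
    with eq show False by simp
  qed
qed

datatype vertex = Start | Finish | Act nat

definition vertices :: "nat \<Rightarrow> vertex set" where
  "vertices n = {Start, Finish} \<union> Act ` {1..n}"

text \<open>
  A directed path \<open>x\<^sub>0 \<rightarrow> \<dots> \<rightarrow> x\<^sub>k\<close> is the list of its \<open>k + 1\<close> vertices. Repeated vertices are not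
  excluded explicitly; they cannot occur when there are no directed cycles.
\<close>

definition dipath :: "vertex rel \<Rightarrow> vertex list \<Rightarrow> bool" where
  "dipath E xs \<longleftrightarrow> xs \<noteq> [] \<and> successively (\<lambda>x y. (x, y) \<in> E) xs"

text \<open>Arrows form a set of ordered pairs, so there are no multiple arrows.\<close>

definition pert_chart :: "nat \<Rightarrow> vertex rel \<Rightarrow> bool" where
  "pert_chart n E \<longleftrightarrow>
     E \<subseteq> vertices n \<times> vertices n \<and>
     irrefl E \<and>
     acyclic E \<and>
     (\<forall>v\<in>vertices n. (Start, v) \<in> E\<^sup>* \<and> (v, Finish) \<in> E\<^sup>*) \<and>
     (\<forall>xs. dipath E xs \<and> length xs \<ge> 3 \<longrightarrow> (hd xs, last xs) \<notin> E)"

definition chart_paths :: "vertex rel \<Rightarrow> nat set set" where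
  "chart_paths E = {{i. Act i \<in> set xs} | xs. dipath E xs \<and> hd xs = Start \<and> last xs = Finish}"

definition earliest_finishing_time :: "vertex rel \<Rightarrow> trop_poly" where
  "earliest_finishing_time E = trop_sum (chart_paths E)"

definition realisable :: "nat \<Rightarrow> trop_poly \<Rightarrow> bool" where
  "realisable n F \<longleftrightarrow> (\<exists>E. pert_chart n E \<and> earliest_finishing_time E = F)"

end

theory Submission
  imports Defs
begin

text \<open>
  PERT charts are Hasse diagrams. For a chart with arrow set \<open>E\<close>, reachability \<open>E\<^sup>+\<close> is a strict
  order on the vertices with least element \<open>Start\<close> and greatest element \<open>Finish\<close>, and the absence
  of short-cuts says exactly that arrows are covering pairs of this order
  (\<open>pert_chart_no_between\<close>). Conversely, the Hasse diagram of a poset on \<open>{1..n}\<close>, extended by a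
  bottom \<open>Start\<close> and a top \<open>Finish\<close>, is a chart whose reachability relation gives back the order
  (\<open>trancl_covers\<close>, \<open>pert_chart_covers_bounded_order\<close>).

  Under this correspondence the paths of the chart are the maximal chains of the poset
  (\<open>chart_paths_eq_maxchains\<close>). A path is a chain because \<open>E\<^sup>+\<close> is transitive. It is maximal
  because an activity comparable with everything on the path but not on it would have to lie
  strictly between two consecutive vertices. In the other direction, any chain can be sorted, and
  the gaps between its consecutive elements can be filled with arrows, so every chain is contained
  in a path; a maximal chain is then equal to that path. The theorem follows since the terms of a
  formal tropical sum determine the sets over which it is taken.
\<close>

section \<open>Chains, sorted lists and covering pairs\<close>

lemma sorted_wrt_comparable:
  assumes "sorted_wrt P xs" "x \<in> set xs" "y \<in> set xs"
  shows "x = y \<or> P x y \<or> P y x"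
  using assms by (induction xs) auto

text \<open>
  Insertion sort: a new element is comparable with all elements of the sorted list, hence splits it
  into the elements below and those above.
\<close>

lemma finite_chain_sorted:
  assumes "finite C" "trans L"
    and "\<And>x y. x \<in> C \<Longrightarrow> y \<in> C \<Longrightarrow> x = y \<or> (x, y) \<in> L \<or> (y, x) \<in> L"
  shows "\<exists>xs. set xs = C \<and> sorted_wrt (\<lambda>x y. (x, y) \<in> L) xs"
  using assms(1,3)
proof (induction C rule: finite_induct)
  case empty
  show ?case by simp
next
  case (insert v C)
  have "\<exists>xs. set xs = C \<and> sorted_wrt (\<lambda>x y. (x, y) \<in> L) xs"
    by (rule insert.IH) (use insert.prems in blast)
  then obtain xs where xs: "set xs = C" "sorted_wrt (\<lambda>x y. (x, y) \<in> L) xs"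
    by blast
  define ys where "ys = filter (\<lambda>x. (x, v) \<in> L) xs @ [v] @ filter (\<lambda>x. (v, x) \<in> L) xs"
  have "set ys = insert v C"
    using insert.prems[of _ v] xs(1) unfolding ys_def by force
  moreover have "sorted_wrt (\<lambda>x y. (x, y) \<in> L) ys"
    unfolding ys_def using xs(2)
    by (auto simp: sorted_wrt_append sorted_wrt_filter intro: transD[OF \<open>trans L\<close>])
  ultimately show ?case by blast
qed

definition covers :: "'a rel \<Rightarrow> 'a rel" where
  "covers L = {(x, y) \<in> L. \<nexists>z. (x, z) \<in> L \<and> (z, y) \<in> L}"

text \<open>
  In a finite strict order every pair is joined by a chain of covering pairs: a non-covering pair
  splits at an intermediate element into two pairs with smaller open intervals.
\<close>

lemma trancl_covers:
  assumes "finite L" "trans L" "irrefl L"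
  shows "(covers L)\<^sup>+ = L"
proof
  have "(covers L)\<^sup>+ \<subseteq> L\<^sup>+"
    by (rule trancl_mono_subset) (auto simp: covers_def)
  then show "(covers L)\<^sup>+ \<subseteq> L"
    using \<open>trans L\<close> by simp
  \<comment> \<open>Induction on the size of the open interval between \<open>x\<close> and \<open>y\<close>.\<close>
  define M where "M x y = {z. (x, z) \<in> L \<and> (z, y) \<in> L}" for x y
  have fin: "finite (M x y)" for x y
    by (rule finite_subset[of _ "Range L"]) (auto simp: M_def finite_Range[OF \<open>finite L\<close>])
  have "(x, y) \<in> L \<longrightarrow> (x, y) \<in> (covers L)\<^sup>+" for x y
  proof (induction "card (M x y)" arbitrary: x y rule: less_induct)
    case less
    show ?case
    proof (intro impI, cases "M x y = {}")
      case True
      assume "(x, y) \<in> L"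
      with True show "(x, y) \<in> (covers L)\<^sup>+"
        by (auto simp: covers_def M_def)
    next
      case False
      then obtain z where z: "(x, z) \<in> L" "(z, y) \<in> L"
        by (auto simp: M_def)
      have "z \<in> M x y" "z \<notin> M x z" "z \<notin> M z y"
        using z \<open>irrefl L\<close> by (auto simp: M_def irrefl_def)
      moreover have "M x z \<subseteq> M x y" "M z y \<subseteq> M x y"
        using z by (auto simp: M_def intro: transD[OF \<open>trans L\<close>])
      ultimately have "card (M x z) < card (M x y)" "card (M z y) < card (M x y)"
        by (auto intro!: psubset_card_mono fin)
      then have "(x, z) \<in> (covers L)\<^sup>+" "(z, y) \<in> (covers L)\<^sup>+"
        using less z by auto
      then show "(x, y) \<in> (covers L)\<^sup>+" by simp
    qed
  qed
  then show "L \<subseteq> (covers L)\<^sup>+" by auto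
qed

section \<open>Directed paths\<close>

lemma dipath_sorted:
  assumes "dipath E xs"
  shows "sorted_wrt (\<lambda>x y. (x, y) \<in> E\<^sup>+) xs"
proof -
  have "successively (\<lambda>x y. (x, y) \<in> E\<^sup>+) xs"
    using assms unfolding dipath_def by (auto elim: successively_mono)
  then show ?thesis
    by (subst (asm) successively_conv_sorted_wrt) (auto simp: transp_def)
qed

lemma dipath_extend_left:
  assumes "(a, hd ys) \<in> E\<^sup>*" "dipath E ys"
  shows "\<exists>zs. dipath E zs \<and> hd zs = a \<and> last zs = last ys \<and> set ys \<subseteq> set zs"
  using assms(1)
proof (induction rule: converse_rtrancl_induct)
  case base
  then show ?case using assms(2) by blast
next
  case (step a b)
  then obtain zs where "dipath E zs" "hd zs = b" "last zs = last ys" "set ys \<subseteq> set zs"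
    by blast
  with step.hyps show ?case
    by (intro exI[of _ "a # zs"]) (auto simp: dipath_def successively_Cons)
qed

text \<open>
  Each step of a list sorted by reachability is a nonempty sequence of arrows, so splicing these
  sequences into the list gives a path with the same ends.
\<close>

lemma sorted_wrt_in_dipath:
  assumes "sorted_wrt (\<lambda>x y. (x, y) \<in> E\<^sup>+) xs" "xs \<noteq> []"
  shows "\<exists>ys. dipath E ys \<and> hd ys = hd xs \<and> last ys = last xs \<and> set xs \<subseteq> set ys"
  using assms
proof (induction xs rule: induct_list012)
  case (2 x)
  show ?case by (rule exI[of _ "[x]"]) (simp add: dipath_def)
next
  case (3 x y xs)
  then obtain ys where ys: "dipath E ys" "hd ys = y" "last ys = last (y # xs)"
      "set (y # xs) \<subseteq> set ys"
    by auto
  moreover have "(x, hd ys) \<in> E\<^sup>*"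
    using 3 ys by (auto intro: trancl_into_rtrancl)
  ultimately obtain zs where "dipath E zs" "hd zs = x" "last zs = last ys" "set ys \<subseteq> set zs"
    using dipath_extend_left by metis
  moreover from this have "x \<in> set zs"
    unfolding dipath_def by (metis hd_in_set)
  ultimately show ?case using ys by (intro exI[of _ zs]) auto
qed simp

text \<open>
  A vertex that is comparable with the whole path changes from being above to being below the
  current vertex somewhere along the path; with no room inside an arrow, it must be a path vertex.
\<close>

lemma comparable_in_dipath:
  assumes between: "\<And>x y z. (x, y) \<in> E \<Longrightarrow> (x, z) \<in> E\<^sup>+ \<Longrightarrow> (z, y) \<in> E\<^sup>+ \<Longrightarrow> False"
    and "acyclic E"
    and "dipath E xs" "(hd xs, v) \<in> E\<^sup>+" "(v, last xs) \<in> E\<^sup>+"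
    and "\<And>x. x \<in> set xs \<Longrightarrow> x = v \<or> (x, v) \<in> E\<^sup>+ \<or> (v, x) \<in> E\<^sup>+"
  shows "v \<in> set xs"
  using assms(3-)
proof (induction xs rule: induct_list012)
  case 1
  then show ?case by (simp add: dipath_def)
next
  case (2 x)
  then have "(x, x) \<in> E\<^sup>+" by (auto intro: trancl_trans)
  with \<open>acyclic E\<close> show ?case by (simp add: acyclic_def)
next
  case (3 x y xs)
  have "(x, y) \<in> E" "dipath E (y # xs)"
    using "3.prems"(1) by (auto simp: dipath_def)
  moreover have "(v, y) \<notin> E\<^sup>+"
    using between[of x y v] \<open>(x, y) \<in> E\<close> "3.prems"(2) by auto
  ultimately show ?case
    using "3.prems"(3,4) "3.IH"(2) by (metis last_ConsR list.distinct(1) list.sel(1) list.set_intros(2,1))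
qed

section \<open>Charts and bounded orders\<close>

text \<open>
  Going from \<open>x\<close> through \<open>z\<close> to \<open>y\<close> gives a path with at least three vertices, so the arrow
  \<open>x \<rightarrow> y\<close> would be a short-cut. Acyclicity makes \<open>x\<close>, \<open>z\<close>, \<open>y\<close> distinct, whence the three vertices.
\<close>

lemma pert_chart_no_between:
  assumes "pert_chart n E" "(x, y) \<in> E" "(x, z) \<in> E\<^sup>+" "(z, y) \<in> E\<^sup>+"
  shows False
proof -
  have no_shortcut: "(hd xs, last xs) \<notin> E" if "dipath E xs" "length xs \<ge> 3" for xs
    using assms(1) that by (auto simp: pert_chart_def)
  have "z \<noteq> y" "x \<noteq> z" "x \<noteq> y"
    using assms by (auto simp: pert_chart_def acyclic_def)
  obtain xs where xs: "dipath E xs" "hd xs = x" "last xs = y" "{x, z, y} \<subseteq> set xs"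
    using sorted_wrt_in_dipath[of E "[x, z, y]"] assms by auto
  have "card {x, z, y} \<le> length xs"
    using xs(4) by (meson List.finite_set card_length card_mono order_trans)
  then have "length xs \<ge> 3"
    using \<open>z \<noteq> y\<close> \<open>x \<noteq> z\<close> \<open>x \<noteq> y\<close> by simp
  then show False
    using no_shortcut xs assms(2) by blast
qed

lemma pert_chart_reach:
  assumes "pert_chart n E" "i \<in> {1..n}"
  shows "(Start, Act i) \<in> E\<^sup>+" "(Act i, Finish) \<in> E\<^sup>+"
  using assms by (auto simp: pert_chart_def vertices_def rtrancl_eq_or_trancl)

lemma chart_paths_subset_Pow:
  assumes "pert_chart n E"
  shows "chart_paths E \<subseteq> Pow {1..n}"
proof -
  have "i \<in> {1..n}" if "dipath E xs" "hd xs = Start" "Act i \<in> set xs" for xs i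
  proof -
    have "(Start, Act i) \<in> E\<^sup>+"
      using dipath_sorted[OF that(1)] that by (cases xs) auto
    then have "Act i \<in> Range E"
      by (metis Range.intros trancl_range)
    then show ?thesis
      using assms by (auto simp: pert_chart_def vertices_def)
  qed
  then show ?thesis unfolding chart_paths_def by blast
qed

abbreviation reach :: "vertex rel \<Rightarrow> nat \<Rightarrow> nat \<Rightarrow> bool" where
  "reach E i j \<equiv> (Act i, Act j) \<in> E\<^sup>+"

lemma chart_path_chain:
  assumes "pert_chart n E" "I \<in> chart_paths E"
  shows "pred_on.chain {1..n} (reach E) I"
proof -
  obtain xs where xs: "dipath E xs" "I = {i. Act i \<in> set xs}"
    using assms(2) by (auto simp: chart_paths_def)
  show ?thesis
    unfolding pred_on.chain_def
    using chart_paths_subset_Pow[OF assms(1)] assms(2) xs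
      sorted_wrt_comparable[OF dipath_sorted[OF xs(1)]] by auto
qed

text \<open>
  \<open>Start\<close> is below and \<open>Finish\<close> above every activity, so they can be put at the ends of a sorted
  chain before its gaps are filled with arrows.
\<close>

lemma chain_in_chart_path:
  assumes chart: "pert_chart n E" and "pred_on.chain {1..n} (reach E) I"
  shows "\<exists>J\<in>chart_paths E. I \<subseteq> J"
proof -
  have I: "I \<subseteq> {1..n}"
    and cmp: "\<And>i j. i \<in> I \<Longrightarrow> j \<in> I \<Longrightarrow> i = j \<or> reach E i j \<or> reach E j i"
    using assms(2) by (auto simp: pred_on.chain_def)
  have "\<exists>xs. set xs = Act ` I \<and> sorted_wrt (\<lambda>x y. (x, y) \<in> E\<^sup>+) xs"
  proof (rule finite_chain_sorted)
    show "finite (Act ` I)"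
      using I by (auto intro: finite_subset)
  qed (use cmp in auto)
  then obtain xs where xs: "set xs = Act ` I" "sorted_wrt (\<lambda>x y. (x, y) \<in> E\<^sup>+) xs"
    by blast
  have "(Start, Finish) \<in> E\<^sup>+"
    using chart by (auto simp: pert_chart_def vertices_def rtrancl_eq_or_trancl)
  then have "sorted_wrt (\<lambda>x y. (x, y) \<in> E\<^sup>+) (Start # xs @ [Finish])"
    using xs I pert_chart_reach[OF chart] by (auto simp: sorted_wrt_append)
  from sorted_wrt_in_dipath[OF this] obtain ys where
    "dipath E ys" "hd ys = Start" "last ys = Finish" "set xs \<subseteq> set ys"
    by auto
  then show ?thesis
    using xs(1) unfolding chart_paths_def by blast
qed

text \<open>
  This is the maximality of paths: no chain extends a path by a new activity.
\<close>

lemma chart_path_absorbs_comparable: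
  assumes chart: "pert_chart n E" and "J \<in> chart_paths E" "i \<in> {1..n}"
    and cmp: "\<And>j. j \<in> J \<Longrightarrow> j = i \<or> reach E j i \<or> reach E i j"
  shows "i \<in> J"
proof -
  obtain xs where xs: "dipath E xs" "hd xs = Start" "last xs = Finish" "J = {j. Act j \<in> set xs}"
    using assms(2) by (auto simp: chart_paths_def)
  have "Act i \<in> set xs"
  proof (rule comparable_in_dipath[OF _ _ xs(1)])
    show False if "(x, y) \<in> E" "(x, z) \<in> E\<^sup>+" "(z, y) \<in> E\<^sup>+" for x y z
      using pert_chart_no_between[OF chart that] .
    show "acyclic E" using chart by (simp add: pert_chart_def)
    fix x assume "x \<in> set xs"
    then show "x = Act i \<or> (x, Act i) \<in> E\<^sup>+ \<or> (Act i, x) \<in> E\<^sup>+"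
      using pert_chart_reach[OF chart assms(3)] cmp xs(4)
      by (cases x rule: vertex.exhaust) auto
  qed (use xs pert_chart_reach[OF chart assms(3)] in auto)
  with xs(4) show ?thesis by simp
qed

lemma chart_paths_eq_maxchains:
  assumes chart: "pert_chart n E"
  shows "chart_paths E = {I. pred_on.maxchain {1..n} (reach E) I}"
proof (intro set_eqI iffI CollectI)
  fix I assume I: "I \<in> chart_paths E"
  have False if "pred_on.chain {1..n} (reach E) S" "I \<subset> S" for S
  proof -
    obtain i where "i \<in> S" "i \<notin> I" using \<open>I \<subset> S\<close> by blast
    moreover from this have "i \<in> I"
      using that by (intro chart_path_absorbs_comparable[OF chart I])
        (auto simp: pred_on.chain_def)
    ultimately show False by simp
  qed
  then show "pred_on.maxchain {1..n} (reach E) I"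
    using chart_path_chain[OF chart I] by (auto simp: pred_on.maxchain_def)
next
  fix I assume "I \<in> {I. pred_on.maxchain {1..n} (reach E) I}"
  then have max: "pred_on.maxchain {1..n} (reach E) I" by simp
  then have I: "pred_on.chain {1..n} (reach E) I"
    by (simp add: pred_on.maxchain_def)
  then obtain J where J: "J \<in> chart_paths E" "I \<subseteq> J"
    using chain_in_chart_path[OF chart] by blast
  have "\<not> I \<subset> J"
    using max chart_path_chain[OF chart J(1)] unfolding pred_on.maxchain_def by metis
  with J show "I \<in> chart_paths E" by (metis psubsetI)
qed

section \<open>The chart of a poset\<close>

definition bounded_order :: "nat \<Rightarrow> nat rel \<Rightarrow> vertex rel" where
  "bounded_order n r =
     {Start} \<times> (vertices n - {Start}) \<union> (vertices n - {Finish}) \<times> {Finish} \<union>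
     {(Act i, Act j) | i j. (i, j) \<in> r \<and> i \<noteq> j}"

lemma in_bounded_order_iff:
  "(Start, v) \<in> bounded_order n r \<longleftrightarrow> v \<in> vertices n \<and> v \<noteq> Start"
  "(v, Start) \<notin> bounded_order n r"
  "(Finish, v) \<notin> bounded_order n r"
  "(v, Finish) \<in> bounded_order n r \<longleftrightarrow> v \<in> vertices n \<and> v \<noteq> Finish"
  "(Act i, Act j) \<in> bounded_order n r \<longleftrightarrow> (i, j) \<in> r - Id"
  by (auto simp: bounded_order_def vertices_def)

lemma bounded_order_strict:
  assumes "partial_order_on {1..n} r"
  shows "bounded_order n r \<subseteq> vertices n \<times> vertices n" "trans (bounded_order n r)"
    "irrefl (bounded_order n r)"
proof -
  have r: "r \<subseteq> {1..n} \<times> {1..n}" "trans r" "antisym r"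
    using partial_order_onD[OF assms] by auto
  show sub: "bounded_order n r \<subseteq> vertices n \<times> vertices n"
    using r(1) by (auto simp: bounded_order_def vertices_def)
  show "trans (bounded_order n r)"
  proof (rule transI)
    fix x y z assume xyz: "(x, y) \<in> bounded_order n r" "(y, z) \<in> bounded_order n r"
    then have "x \<in> vertices n" "z \<in> vertices n" "x \<noteq> Finish" "z \<noteq> Start"
      using sub by (auto simp: in_bounded_order_iff)
    moreover have "(i, k) \<in> r - Id" if "x = Act i" "z = Act k" for i k
    proof -
      obtain j where "y = Act j"
        using xyz that by (cases y) (auto simp: in_bounded_order_iff)
      then show ?thesis
        using xyz that transD[OF trans_diff_Id[OF r(2,3)]] by (simp only: in_bounded_order_iff)
    qed
    ultimately show "(x, z) \<in> bounded_order n r"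
      by (cases x; cases z) (simp_all only: in_bounded_order_iff, simp_all)
  qed
  show "irrefl (bounded_order n r)"
    by (auto simp: bounded_order_def irrefl_def)
qed

lemma trancl_covers_bounded_order:
  assumes "partial_order_on {1..n} r"
  shows "(covers (bounded_order n r))\<^sup>+ = bounded_order n r"
proof (rule trancl_covers)
  have "finite (vertices n)" by (simp add: vertices_def)
  then show "finite (bounded_order n r)"
    using bounded_order_strict(1)[OF assms] by (meson finite_SigmaI finite_subset)
qed (use bounded_order_strict[OF assms] in auto)

lemma pert_chart_covers_bounded_order:
  assumes "partial_order_on {1..n} r"
  shows "pert_chart n (covers (bounded_order n r))"
proof -
  define L where "L = bounded_order n r"
  have L: "L \<subseteq> vertices n \<times> vertices n" "trans L" "irrefl L" "(covers L)\<^sup>+ = L"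
    using bounded_order_strict[OF assms] trancl_covers_bounded_order[OF assms]
    by (auto simp: L_def)
  have sub: "covers L \<subseteq> L" by (auto simp: covers_def)
  have irrefl_covers: "irrefl (covers L)"
    using L(3) sub by (auto simp: irrefl_def)
  have "acyclic (covers L)"
    using L by (simp add: acyclic_irrefl)
  moreover have "(Start, v) \<in> (covers L)\<^sup>*" "(v, Finish) \<in> (covers L)\<^sup>*" if "v \<in> vertices n" for v
    using that L(4) by (auto simp: rtrancl_eq_or_trancl L_def bounded_order_def)
  moreover have "(hd xs, last xs) \<notin> covers L" if "dipath (covers L) xs" "length xs \<ge> 3" for xs
  proof -
    \<comment> \<open>The second vertex of the path lies strictly between its ends.\<close>
    obtain a b ys where xs: "xs = a # b # ys" "ys \<noteq> []"
      using \<open>length xs \<ge> 3\<close> by (auto simp: numeral_3_eq_3 Suc_le_length_iff)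
    have "(a, b) \<in> L" "(b, last xs) \<in> L"
      using dipath_sorted[OF that(1)] xs L(4) by auto
    then show ?thesis
      using xs(1) by (auto simp: covers_def)
  qed
  ultimately show ?thesis
    unfolding pert_chart_def L_def[symmetric]
    using L(1) irrefl_covers sub by (simp add: subset_trans[OF sub])
qed

section \<open>Realisable polynomials and maximal chains\<close>

lemma chain_cong:
  assumes "\<And>i j. i \<in> A \<Longrightarrow> j \<in> A \<Longrightarrow> i \<noteq> j \<Longrightarrow> P i j \<longleftrightarrow> Q i j"
  shows "pred_on.chain A P = pred_on.chain A Q"
proof -
  have "x \<in> A \<Longrightarrow> y \<in> A \<Longrightarrow> P\<^sup>=\<^sup>= x y \<longleftrightarrow> Q\<^sup>=\<^sup>= x y" for x y
    using assms by auto
  then show ?thesis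
    unfolding pred_on.chain_def fun_eq_iff by blast
qed

text \<open>
  Chains use the reflexive closure of the relation, so it does not matter that a poset is reflexive
  while reachability in a chart is irreflexive.
\<close>

lemma maxchain_cong:
  assumes "\<And>i j. i \<in> A \<Longrightarrow> j \<in> A \<Longrightarrow> i \<noteq> j \<Longrightarrow> P i j \<longleftrightarrow> Q i j"
  shows "pred_on.maxchain A P = pred_on.maxchain A Q"
  unfolding pred_on.maxchain_def using chain_cong[of A P Q] assms by simp

lemma pert_chart_partial_order:
  assumes "pert_chart n E"
  shows "partial_order_on {1..n} {(i, j) \<in> {1..n} \<times> {1..n}. i = j \<or> reach E i j}"
proof -
  have "acyclic E" using assms by (simp add: pert_chart_def)
  then have "\<not> reach E i j \<or> \<not> reach E j i" for i j
    unfolding acyclic_def by (blast dest: trancl_trans)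
  then show ?thesis
    unfolding partial_order_on_def preorder_on_def
    by (auto simp: refl_on_def intro!: antisymI transI intro: trancl_trans)
qed

theorem proposition3p2:
  fixes n :: nat and \<I> :: "nat set set" and F :: trop_poly
  assumes "n \<ge> 1"
    and "\<I> \<subseteq> Pow {1..n}" and "\<I> \<noteq> {}"
    and "F = trop_sum \<I>"
  shows "realisable n F \<longleftrightarrow>
    (\<exists>r. partial_order_on {1..n} r \<and>
      (\<forall>I. I \<subseteq> {1..n} \<longrightarrow>
        (pred_on.maxchain {1..n} (\<lambda>i j. (i, j) \<in> r) I \<longleftrightarrow> is_term I F)))"
proof
  assume "realisable n F"
  then obtain E where chart: "pert_chart n E" and F: "F = trop_sum (chart_paths E)"
    by (auto simp: realisable_def earliest_finishing_time_def)
  define r where "r = {(i, j) \<in> {1..n} \<times> {1..n}. i = j \<or> reach E i j}"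
  have "pred_on.maxchain {1..n} (\<lambda>i j. (i, j) \<in> r) = pred_on.maxchain {1..n} (reach E)"
    by (rule maxchain_cong) (auto simp: r_def)
  then have "pred_on.maxchain {1..n} (\<lambda>i j. (i, j) \<in> r) I \<longleftrightarrow> is_term I F" if "I \<subseteq> {1..n}" for I
    using is_term_trop_sum[OF chart_paths_subset_Pow[OF chart] that] F
      chart_paths_eq_maxchains[OF chart] by simp
  then show "\<exists>r. partial_order_on {1..n} r \<and> (\<forall>I. I \<subseteq> {1..n} \<longrightarrow>
      (pred_on.maxchain {1..n} (\<lambda>i j. (i, j) \<in> r) I \<longleftrightarrow> is_term I F))"
    using pert_chart_partial_order[OF chart] unfolding r_def by blast
next
  assume "\<exists>r. partial_order_on {1..n} r \<and> (\<forall>I. I \<subseteq> {1..n} \<longrightarrow>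
      (pred_on.maxchain {1..n} (\<lambda>i j. (i, j) \<in> r) I \<longleftrightarrow> is_term I F))"
  then obtain r where r: "partial_order_on {1..n} r"
    and max: "\<And>I. I \<subseteq> {1..n} \<Longrightarrow>
      pred_on.maxchain {1..n} (\<lambda>i j. (i, j) \<in> r) I \<longleftrightarrow> is_term I F"
    by blast
  define E where "E = covers (bounded_order n r)"
  have chart: "pert_chart n E"
    unfolding E_def by (rule pert_chart_covers_bounded_order[OF r])
  have "pred_on.maxchain {1..n} (reach E) = pred_on.maxchain {1..n} (\<lambda>i j. (i, j) \<in> r)"
    unfolding E_def trancl_covers_bounded_order[OF r]
    by (rule maxchain_cong) (auto simp: bounded_order_def)
  then have "I \<in> chart_paths E \<longleftrightarrow> I \<in> \<I>" if "I \<subseteq> {1..n}" for I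
    using that max is_term_trop_sum[OF assms(2) that] assms(4)
      chart_paths_eq_maxchains[OF chart] by simp
  then have "chart_paths E = \<I>"
    using chart_paths_subset_Pow[OF chart] assms(2) by blast
  then show "realisable n F"
    using chart assms(4) by (auto simp: realisable_def earliest_finishing_time_def)
qed

end
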